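(* Let $G$ be a finite group with representation ring $R(G)$, and let $F(q)=q^{-1}+a_1q+a_2q^2+\cdots\in R(G)((q))$ be a McKay–Thompson series. Then $F$ is replicable if and only if $$F(t)-F(q)=t^{-1}\cdot\Lambda^{Tate}_{-t}(F(q)).$$
   Context: $R(G)$ is the complex representation ring of $G$, with Adams operations $\psi_a$ (on characters, $\psi_a(\chi)(g)=\chi(g^a)$). A McKay–Thompson series is a Laurent series of the form $F(q)=q^{-1}+a_1q+a_2q^2+\cdots$ with $a_i\in R(G)$. $F^{(a)}$ denotes the series obtained by applying $\psi_a$ to the coefficients of $F$. With $q=e^{2\pi i\tau}$ one also writes $F(\tau)$ for $F(q)$. Hecke operators: for $m\ge1$, $$T_m(F)(q)=\frac1m\sum_{ad=m}\ \sum_{0\le b<d}F^{(a)}\Big(\frac{a\tau+b}{d}\Big)\in (R(G)\otimes\mathbb Q)((q)).$$ Total exterior power: $\Lambda_t^{Tate}(F)=(S_{-t}^{Tate}(F))^{-1}$, where $S_t^{Tate}(F)=\exp(\sum_{m\ge1}T_m(F)t^m)$; so $$\Lambda^{Tate}_{-t}(F)=\exp\Big(-\sum_{m\ge1}T_m(F)t^m\Big).$$ Faber polynomials: $\Phi_{m,F}(w)$, $m\ge1$, are the polynomials of degree $m$ in $w$ defined by $$-\sum_{m\ge1}\frac{\Phi_{m,F}(w)}{m}t^m=\log\big(t(F(t)-w)\big);$$ $\Phi_{m,F}$ is characterized by $\Phi_{m,F}(F(q))=q^{-m}+b_1q+b_2q^2+\cdots$. $F$ is called replicable if for every natural number $m\ge1$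 one has $\Phi_{m,F}(F(q))=\sum_{ad=m}\sum_{0\le b<d}F^{(a)}\big(\frac{a\tau+b}{d}\big)=m\cdot T_m(F)(q)$. The identity in the claim is one of formal series: after multiplication by $t$, in the ring $(R(G)\otimes\mathbb Q)((q))[[t]]$. *)

theory Defs
  imports
    "HOL-Library.Function_Algebras"
    "HOL-Computational_Algebra.Computational_Algebra"
    "HOL-Algebra.Group"
    "Jordan_Normal_Form.Matrix"
begin

section \<open>The representation ring of a finite group\<close>

text \<open>
  R(G) is realised as the ring of virtual characters. All coefficient rings in sight (R(G) itself,
  its rational span R(G) \<otimes> Q, and its span over the cyclotomic numbers, which occur only inside
  the Hecke operators) are subrings of the ring of complex functions with pointwise operations.

  The type \<^typ>\<open>'g \<Rightarrow> complex\<close> also contains values outside the carrier of G. These carry no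
  information: a function on G is stored as a function on the whole type by giving it its value at
  the identity element there. (Extension by 0 would not do, since then the unit of R(G) would not
  be the constant function 1.)
\<close>

definition to_group :: "('g, 'x) monoid_scheme \<Rightarrow> 'g \<Rightarrow> 'g" where
  "to_group G x = (if x \<in> carrier G then x else \<one>\<^bsub>G\<^esub>)"

abbreviation GL :: "nat \<Rightarrow> complex mat monoid" where
  "GL n \<equiv> units_of (ring_mat TYPE(complex) n ())"

definition rep_character :: "('g, 'x) monoid_scheme \<Rightarrow> ('g \<Rightarrow> complex mat) \<Rightarrow> 'g \<Rightarrow> complex" where
  "rep_character G \<rho> x = sum_list (diag_mat (\<rho> (to_group G x)))"

definition characters :: "('g, 'x) monoid_scheme \<Rightarrow> ('g \<Rightarrow> complex) set" where
  "characters G = {rep_character G \<rho> | \<rho> n. \<rho> \<in> hom G (GL n)}"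

definition rep_ring :: "('g, 'x) monoid_scheme \<Rightarrow> ('g \<Rightarrow> complex) set" where
  "rep_ring G = {\<phi> - \<psi> | \<phi> \<psi>. \<phi> \<in> characters G \<and> \<psi> \<in> characters G}"

definition adams :: "('g, 'x) monoid_scheme \<Rightarrow> nat \<Rightarrow> ('g \<Rightarrow> complex) \<Rightarrow> 'g \<Rightarrow> complex" where
  "adams G a \<phi> x = \<phi> (to_group G x [^]\<^bsub>G\<^esub> a)"

abbreviation scalar :: "complex \<Rightarrow> 'g \<Rightarrow> complex" where
  "scalar c \<equiv> (\<lambda>_. c)"


section \<open>McKay--Thompson series and Hecke operators\<close>

definition mckay_thompson :: "('g, 'x) monoid_scheme \<Rightarrow> ('g \<Rightarrow> complex) fls \<Rightarrow> bool" where
  "mckay_thompson G F \<longleftrightarrow>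
     (\<forall>n < -1. fls_nth F n = 0) \<and> fls_nth F (-1) = 1 \<and> fls_nth F 0 = 0 \<and>
     (\<forall>n \<ge> 1. fls_nth F n \<in> rep_ring G)"

definition adams_series ::
    "('g, 'x) monoid_scheme \<Rightarrow> nat \<Rightarrow> ('g \<Rightarrow> complex) fls \<Rightarrow> ('g \<Rightarrow> complex) fls" where
  "adams_series G a F = Abs_fls (\<lambda>n. adams G a (fls_nth F n))"

text \<open>The substitution \<open>q \<mapsto> \<omega> q\<close> for a nonzero complex number \<open>\<omega>\<close>.\<close>

definition fls_rotate :: "complex \<Rightarrow> ('g \<Rightarrow> complex) fls \<Rightarrow> ('g \<Rightarrow> complex) fls" where
  "fls_rotate \<omega> F = Abs_fls (\<lambda>n. scalar (\<omega> powi n) * fls_nth F n)"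

text \<open>
  The series \<open>F((a\<tau>+b)/d)\<close>: with \<open>q = e^{2\<pi>i\<tau>}\<close> the variable \<open>q\<close> is replaced by
  \<open>\<zeta>^b q^{a/d}\<close>, where \<open>\<zeta> = e^{2\<pi>i/d}\<close>. The value is a Laurent series in \<open>u = q^{1/d}\<close>, so what is
  formed is \<open>F(\<zeta>^b u^a)\<close>.
\<close>

definition moebius_subst :: "nat \<Rightarrow> nat \<Rightarrow> nat \<Rightarrow> ('g \<Rightarrow> complex) fls \<Rightarrow> ('g \<Rightarrow> complex) fls" where
  "moebius_subst a b d F = fls_compose_power (fls_rotate (cis (2 * pi * real b / real d)) F) a"

text \<open>
  Reads a Laurent series in \<open>u = q^{1/d}\<close> as a Laurent series in \<open>q\<close>. It is applied only to sums over
  \<open>b\<close>, in which all exponents of \<open>u\<close> are multiples of \<open>d\<close>; see \<open>from_root_sum_moebius_subst\<close> below.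
\<close>

definition from_root :: "nat \<Rightarrow> ('g \<Rightarrow> complex) fls \<Rightarrow> ('g \<Rightarrow> complex) fls" where
  "from_root d H = Abs_fls (\<lambda>n. fls_nth H (n * int d))"

definition hecke_sum ::
    "('g, 'x) monoid_scheme \<Rightarrow> nat \<Rightarrow> ('g \<Rightarrow> complex) fls \<Rightarrow> ('g \<Rightarrow> complex) fls" where
  "hecke_sum G m F =
     (\<Sum>(a, d) | a * d = m. from_root d (\<Sum>b<d. moebius_subst a b d (adams_series G a F)))"

definition hecke ::
    "('g, 'x) monoid_scheme \<Rightarrow> nat \<Rightarrow> ('g \<Rightarrow> complex) fls \<Rightarrow> ('g \<Rightarrow> complex) fls" where
  "hecke G m F = fls_const (scalar (1 / of_nat m)) * hecke_sum G m F"


section \<open>Exponential and logarithm over algebras containing the rationals\<close>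

text \<open>
  The library's \<^const>\<open>fps_exp\<close> and \<^const>\<open>fps_ln\<close> need a field of coefficients. Here the
  coefficients lie in a commutative ring into which scalars are sent by \<open>\<iota>\<close>, which is used only at
  rational numbers. The series \<open>f\<close> is
  required to have constant term 0 in \<open>exp f\<close> and constant term 1 in \<open>log f\<close>.
\<close>

definition exp_series :: "(complex \<Rightarrow> 'r::comm_ring_1) \<Rightarrow> 'r fps \<Rightarrow> 'r fps" where
  "exp_series \<iota> f = fps_compose (Abs_fps (\<lambda>n. \<iota> (1 / fact n))) f"

definition log_series :: "(complex \<Rightarrow> 'r::comm_ring_1) \<Rightarrow> 'r fps \<Rightarrow> 'r fps" where
  "log_series \<iota> f =
     fps_compose (Abs_fps (\<lambda>n. if n = 0 then 0 else \<iota> ((-1) ^ (n + 1) / of_nat n))) (f - 1)"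


section \<open>Total symmetric and exterior powers\<close>

definition sym_tate ::
    "('g, 'x) monoid_scheme \<Rightarrow> ('g \<Rightarrow> complex) fls \<Rightarrow> ('g \<Rightarrow> complex) fls fps" where
  "sym_tate G F =
     exp_series (\<lambda>c. fls_const (scalar c)) (Abs_fps (\<lambda>m. if m = 0 then 0 else hecke G m F))"

text \<open>
  The value at \<open>-t\<close> of a series in \<open>t\<close> is its composition with \<open>- fps_X\<close>. The constant term of
  \<^const>\<open>sym_tate\<close> is 1, and \<^term>\<open>fps_right_inverse f 1\<close> is then the inverse of \<open>f\<close>; see
  \<open>ext_tate_inverse\<close> below.
\<close>

definition ext_tate ::
    "('g, 'x) monoid_scheme \<Rightarrow> ('g \<Rightarrow> complex) fls \<Rightarrow> ('g \<Rightarrow> complex) fls fps" where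
  "ext_tate G F = fps_right_inverse (fps_compose (sym_tate G F) (- fps_X)) 1"


section \<open>Faber polynomials and replicability\<close>

text \<open>
  The power series \<open>t (F(t) - w)\<close> in \<open>t\<close> for a series \<open>F\<close> without terms of degree below \<open>-1\<close>. The
  coefficients of \<open>F\<close> are carried by \<open>h\<close> into the ring in which \<open>w\<close> lives: polynomials in \<open>w\<close> for
  the Faber polynomials, Laurent series in \<open>q\<close> for \<open>t (F(t) - F(q))\<close>.
\<close>

definition t_times_diff ::
    "(('g \<Rightarrow> complex) \<Rightarrow> 'r::comm_ring_1) \<Rightarrow> ('g \<Rightarrow> complex) fls \<Rightarrow> 'r \<Rightarrow> 'r fps" where
  "t_times_diff h F w = Abs_fps (\<lambda>n. h (fls_nth F (int n - 1))) - fps_const w * fps_X"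

definition faber :: "nat \<Rightarrow> ('g \<Rightarrow> complex) fls \<Rightarrow> ('g \<Rightarrow> complex) poly" where
  "faber m F =
     - of_nat m * fps_nth (log_series (\<lambda>c. [:scalar c:]) (t_times_diff (\<lambda>c. [:c:]) F [:0, 1:])) m"

definition replicable :: "('g, 'x) monoid_scheme \<Rightarrow> ('g \<Rightarrow> complex) fls \<Rightarrow> bool" where
  "replicable G F \<longleftrightarrow>
     (\<forall>m \<ge> 1. poly (map_poly fls_const (faber m F)) F = hecke_sum G m F)"


section \<open>Well-definedness\<close>

lemma fls_nth_Abs_fls_supp:
  assumes "\<And>n. n < N \<Longrightarrow> f n = 0"
  shows "fls_nth (Abs_fls f) n = f n"
  by (rule nth_Abs_fls_ex_lower_bound) (use assms in blast)

lemma fls_nth_adams_series: "fls_nth (adams_series G a F) n = adams G a (fls_nth F n)"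
  unfolding adams_series_def
  by (rule fls_nth_Abs_fls_supp[of "fls_subdegree F"]) (simp add: adams_def fun_eq_iff)

lemma fls_nth_rotate: "fls_nth (fls_rotate \<omega> F) n = scalar (\<omega> powi n) * fls_nth F n"
  unfolding fls_rotate_def
  by (rule fls_nth_Abs_fls_supp[of "fls_subdegree F"]) simp

lemma fls_nth_from_root:
  assumes "d > 0"
  shows "fls_nth (from_root d H) n = fls_nth H (n * int d)"
  unfolding from_root_def
proof (rule fls_nth_Abs_fls_supp[of "min 0 (fls_subdegree H)"])
  fix k :: int assume k: "k < min 0 (fls_subdegree H)"
  have "k * int d \<le> k * 1"
    using k assms by (intro mult_left_mono_neg) auto
  with k have "k * int d < fls_subdegree H" by linarith
  then show "fls_nth H (k * int d) = 0" by simp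
qed

lemma sum_cis_powi:
  assumes "d > 0" "\<not> int d dvd k"
  shows "(\<Sum>b<d. cis (2 * pi * real b / real d) powi k) = 0"
proof -
  define z where "z = cis (2 * pi * of_int k / real d)"
  have pw: "cis (2 * pi * real b / real d) powi k = z ^ b" for b
    by (simp add: z_def cis_power_int DeMoivre mult_ac)
  have "z ^ d = cis (2 * pi * of_int k)"
    using assms by (simp add: z_def DeMoivre)
  also have "\<dots> = 1" by (simp add: cis_multiple_2pi)
  finally have zd: "z ^ d = 1" .
  have "z \<noteq> 1"
  proof
    assume "z = 1"
    then have "cos (2 * pi * of_int k / real d) = 1"
      by (simp add: z_def complex_eq_iff)
    then obtain j :: int where "2 * pi * of_int k / real d = of_int j * 2 * pi"
      by (auto simp: cos_one_2pi_int)
    then have "real_of_int k = of_int (j * int d)"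
      using assms by (simp add: field_simps)
    then have "k = j * int d" by linarith
    with assms show False by simp
  qed
  then show ?thesis
    by (simp add: pw geometric_sum zd)
qed

lemma fls_nth_sum_moebius_subst:
  assumes "a > 0" "d > 0" "\<not> int d dvd n"
  shows "fls_nth (\<Sum>b<d. moebius_subst a b d F) n = 0"
proof (cases "int a dvd n")
  case True
  then obtain k where k: "n = int a * k" by blast
  with assms have "\<not> int d dvd k" by auto
  have "fls_nth (\<Sum>b<d. moebius_subst a b d F) n =
      (\<Sum>b<d. scalar (cis (2 * pi * real b / real d) powi k) * fls_nth F k)"
    using assms by (simp add: fls_nth_sum moebius_subst_def fls_nth_compose_power k fls_nth_rotate)
  also have "\<dots> = scalar (\<Sum>b<d. cis (2 * pi * real b / real d) powi k) * fls_nth F k"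
  proof
    fix x
    have "(\<Sum>b\<in>B. scalar (c b) * f) x = (\<Sum>b\<in>B. c b) * f x"
      for B and c :: "nat \<Rightarrow> complex" and f :: "'a \<Rightarrow> complex"
      by (induction B rule: infinite_finite_induct) (auto simp: algebra_simps)
    then show "(\<Sum>b<d. scalar (cis (2 * pi * real b / real d) powi k) * fls_nth F k) x =
        (scalar (\<Sum>b<d. cis (2 * pi * real b / real d) powi k) * fls_nth F k) x"
      by simp
  qed
  also have "\<dots> = 0"
    using sum_cis_powi[OF \<open>d > 0\<close> \<open>\<not> int d dvd k\<close>] by (simp add: fun_eq_iff)
  finally show ?thesis .
next
  case False
  with assms show ?thesis
    by (simp add: fls_nth_sum moebius_subst_def fls_nth_compose_power)
qed

text \<open>Substituting \<open>q = u^d\<close> gives back the sum over \<open>b\<close>.\<close>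

lemma from_root_sum_moebius_subst:
  assumes "a > 0" "d > 0"
  shows "fls_compose_power (from_root d (\<Sum>b<d. moebius_subst a b d F)) d =
         (\<Sum>b<d. moebius_subst a b d F)"
proof (rule fls_eqI)
  fix n
  show "fls_nth (fls_compose_power (from_root d (\<Sum>b<d. moebius_subst a b d F)) d) n =
        fls_nth (\<Sum>b<d. moebius_subst a b d F) n"
    using assms fls_nth_sum_moebius_subst[OF assms]
    by (cases "int d dvd n") (simp_all add: fls_nth_compose_power fls_nth_from_root)
qed

lemma ext_tate_inverse: "fps_compose (sym_tate G F) (- fps_X) * ext_tate G F = 1"
  unfolding ext_tate_def
proof (rule fps_right_inverse)
  have "scalar (1::complex) = (1 :: 'a \<Rightarrow> complex)" by (simp add: fun_eq_iff)
  then show "fps_nth (fps_compose (sym_tate G F) (- fps_X)) 0 * 1 = 1"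
    by (simp add: sym_tate_def exp_series_def)
qed

end

(*
  Let A = t (F(t) - F(q)) and let H be the sum of T_m(F)(q) t^m over m >= 1. Substituting F(q) for w
  in the definition of the Faber polynomials gives Phi_m(F(q)) = - m [t^m] log A, so F is replicable
  iff log A = - H. Instead of inverting exp and log, differentiate in t: as A and S = exp H are
  units, log A = - H iff A' = - H' A iff (S A)' = 0 iff S A = 1, that is, A is the inverse of S.
*)

theory Submission
  imports Defs
begin

section \<open>Composition of power series over commutative rings\<close>

text \<open>
  The library proves the chain rule and the multiplicativity of composition for integral domains
  only; rings of functions have zero divisors.
\<close>

lemma fps_power_nth_eq_0:
  fixes b :: "'a::comm_ring_1 fps"
  assumes "fps_nth b 0 = 0" "n < i"
  shows "fps_nth (b ^ i) n = 0"
  using startsby_zero_power_prefix[OF assms(1)] assms(2) by blast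

text \<open>In degree \<open>j\<close> the composition sums over \<open>i\<close> up to
  \<open>j\<close>. As \<open>b ^ i\<close> has no terms below degree \<open>i\<close>, every such
  sum may run up to \<open>n\<close>, and then it can be exchanged with the sum of the product by
  \<open>c\<close>.\<close>

lemma fps_compose_mult_nth:
  fixes a b c :: "'a::comm_ring_1 fps"
  assumes b0: "fps_nth b 0 = 0"
  shows "fps_nth (fps_compose a b * c) n = (\<Sum>i\<le>n. fps_nth a i * fps_nth (b ^ i * c) n)"
proof -
  have "fps_nth (fps_compose a b) j = (\<Sum>i\<le>n. fps_nth a i * fps_nth (b ^ i) j)" if "j \<le> n" for j
    unfolding fps_compose_nth using that fps_power_nth_eq_0[OF b0]
    by (intro sum.mono_neutral_left) auto
  then have "fps_nth (fps_compose a b * c) n =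
      (\<Sum>j=0..n. \<Sum>i\<le>n. fps_nth a i * (fps_nth (b ^ i) j * fps_nth c (n - j)))"
    by (simp add: fps_mult_nth sum_distrib_right mult.assoc)
  also have "\<dots> = (\<Sum>i\<le>n. fps_nth a i * fps_nth (b ^ i * c) n)"
    by (subst sum.swap) (simp add: fps_mult_nth sum_distrib_left)
  finally show ?thesis .
qed

lemma fps_compose_deriv_comm_ring:
  fixes a b :: "'a::comm_ring_1 fps"
  assumes b0: "fps_nth b 0 = 0"
  shows "fps_deriv (fps_compose a b) = fps_compose (fps_deriv a) b * fps_deriv b"
proof (rule fps_ext)
  fix n
  have "fps_nth (fps_deriv (fps_compose a b)) n =
      (\<Sum>i\<le>Suc n. fps_nth a i * fps_nth (fps_deriv (b ^ i)) n)"
    by (simp only: fps_compose_nth fps_deriv_nth sum_distrib_left atLeast0AtMost Suc_eq_plus1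
        mult.left_commute)
  \<comment> \<open>The term of index 0 vanishes because \<open>b ^ 0 = 1\<close> has derivative
    0.\<close>
  also have "\<dots> = (\<Sum>i\<le>n. fps_nth a (Suc i) * fps_nth (fps_deriv (b ^ Suc i)) n)"
    by (subst sum.atMost_Suc_shift) simp
  also have "\<dots> = (\<Sum>i\<le>n. fps_nth (fps_deriv a) i * fps_nth (b ^ i * fps_deriv b) n)"
  proof (rule sum.cong)
    fix i
    have "fps_deriv (b ^ Suc i) = of_nat (Suc i) * (b ^ i * fps_deriv b)"
      by (simp only: fps_deriv_power' diff_Suc_1 mult.assoc mult.commute[of "fps_deriv b"])
    then have "fps_nth (fps_deriv (b ^ Suc i)) n = of_nat (Suc i) * fps_nth (b ^ i * fps_deriv b) n"
      by (simp only: fps_of_nat[symmetric] fps_mult_left_const_nth)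
    then show "fps_nth a (Suc i) * fps_nth (fps_deriv (b ^ Suc i)) n =
        fps_nth (fps_deriv a) i * fps_nth (b ^ i * fps_deriv b) n"
      by (simp only: fps_deriv_nth[of a] Suc_eq_plus1 mult_ac)
  qed simp
  also have "\<dots> = fps_nth (fps_compose (fps_deriv a) b * fps_deriv b) n"
    by (simp only: fps_compose_mult_nth[OF b0])
  finally show "fps_nth (fps_deriv (fps_compose a b)) n =
      fps_nth (fps_compose (fps_deriv a) b * fps_deriv b) n" .
qed

text \<open>Both sides collect the terms \<open>?f i j\<close>: the product of the compositions over
  a square of index pairs, the composition of the product over the triangle
  \<open>i + j \<le> n\<close>, ordered by \<open>s = i + j\<close>.\<close>

lemma fps_compose_mult_distrib_comm_ring:
  fixes a b c :: "'a::comm_ring_1 fps"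
  assumes c0: "fps_nth c 0 = 0"
  shows "fps_compose (a * b) c = fps_compose a c * fps_compose b c"
proof (rule fps_ext)
  fix n
  let ?f = "\<lambda>i j. fps_nth a i * (fps_nth b j * fps_nth (c ^ (i + j)) n)"
  have "fps_nth (fps_compose a c * fps_compose b c) n =
      (\<Sum>i\<le>n. fps_nth a i * fps_nth (fps_compose b c * c ^ i) n)"
    by (simp only: fps_compose_mult_nth[OF c0, of a] mult.commute[of "c ^ _" "fps_compose b c"])
  also have "\<dots> = (\<Sum>i\<le>n. \<Sum>j\<le>n. ?f i j)"
    by (simp only: fps_compose_mult_nth[OF c0] sum_distrib_left add.commute flip: power_add)
  also have "\<dots> = (\<Sum>(i, j)\<in>{..n} \<times> {..n}. ?f i j)"
    by (simp add: sum.cartesian_product)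
  \<comment> \<open>For \<open>i + j > n\<close> the power \<open>c ^ (i + j)\<close> has no term of
    degree \<open>n\<close>.\<close>
  also have "\<dots> = (\<Sum>(i, j)\<in>{(i, j). i + j \<le> n}. ?f i j)"
    by (rule sum.mono_neutral_right) (auto, metis fps_power_nth_eq_0[OF c0] mult_zero_right not_le)
  also have "\<dots> = (\<Sum>s\<le>n. \<Sum>i\<le>s. ?f i (s - i))"
    by (rule sum.triangle_reindex_eq)
  also have "\<dots> = fps_nth (fps_compose (a * b) c) n"
    by (simp add: fps_compose_nth fps_mult_nth sum_distrib_right atLeast0AtMost mult.assoc)
  finally show "fps_nth (fps_compose (a * b) c) n = fps_nth (fps_compose a c * fps_compose b c) n" ..
qed

lemma fps_compose_uminus_X_nth:
  fixes f :: "'a::comm_ring_1 fps"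
  shows "fps_nth (fps_compose f (- fps_X)) n = (- 1) ^ n * fps_nth f n"
proof -
  have "fps_nth ((- fps_X :: 'a fps) ^ i) n = (if i = n then (- 1) ^ n else 0)" for i
    by (subst power_minus) (auto simp: minus_one_power_iff fps_X_power_nth)
  then show ?thesis
    by (simp add: fps_compose_nth mult_delta_right mult.commute)
qed

lemma fps_compose_uminus_X_involution:
  fixes f :: "'a::comm_ring_1 fps"
  shows "fps_compose (fps_compose f (- fps_X)) (- fps_X) = f"
  by (rule fps_ext) (simp add: fps_compose_uminus_X_nth flip: mult.assoc power_add)


lemma left_inverse_imp_mult_cancel:
  fixes f :: "'a::monoid_mult"
  assumes "u * f = 1"
  shows "f * x = f * y \<longleftrightarrow> x = y"
proof
  assume "f * x = f * y"
  then have "u * f * x = u * f * y" by (simp only: mult.assoc)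
  with assms show "x = y" by simp
qed simp


section \<open>Exponential and logarithm\<close>

text \<open>The element \<open>\<iota> (1 / of_nat m)\<close> is an inverse of
  \<open>of_nat m\<close>, so positive integers cancel even in the presence of zero
  divisors.\<close>

lemma of_nat_mult_cancel_hom:
  fixes \<iota> :: "complex \<Rightarrow> 'r::comm_ring_1" and x y :: 'r
  assumes "comm_ring_hom \<iota>" "m > 0"
  shows "of_nat m * x = of_nat m * y \<longleftrightarrow> x = y"
proof -
  interpret comm_ring_hom \<iota> by fact
  have "\<iota> (1 / of_nat m) * of_nat m = \<iota> (1 / of_nat m * of_nat m)"
    by (simp only: hom_mult hom_of_nat)
  also have "\<dots> = 1" using assms(2) by simp
  finally show ?thesis by (rule left_inverse_imp_mult_cancel)
qed

lemma fps_deriv_cancel_hom: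
  fixes \<iota> :: "complex \<Rightarrow> 'r::comm_ring_1" and f g :: "'r fps"
  assumes "comm_ring_hom \<iota>" "fps_nth f 0 = fps_nth g 0"
  shows "fps_deriv f = fps_deriv g \<longleftrightarrow> f = g"
proof
  assume eq: "fps_deriv f = fps_deriv g"
  show "f = g"
  proof (rule fps_ext)
    fix n
    show "fps_nth f n = fps_nth g n"
    proof (cases n)
      case (Suc k)
      from eq have "fps_nth (fps_deriv f) k = fps_nth (fps_deriv g) k" by simp
      then have "of_nat (Suc k) * fps_nth f (Suc k) = of_nat (Suc k) * fps_nth g (Suc k)"
        by (simp only: fps_deriv_nth Suc_eq_plus1)
      with Suc show ?thesis
        using of_nat_mult_cancel_hom[OF assms(1)] by blast
    qed (use assms in simp)
  qed
qed simp

lemma exp_series_nth_0: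
  assumes "comm_ring_hom \<iota>"
  shows "fps_nth (exp_series \<iota> f) 0 = 1"
proof -
  interpret comm_ring_hom \<iota> by fact
  show ?thesis by (simp add: exp_series_def)
qed

text \<open>The series \<open>?E\<close> is its own derivative; the rest is the chain rule.\<close>

lemma exp_series_deriv:
  assumes "comm_ring_hom \<iota>" "fps_nth f 0 = 0"
  shows "fps_deriv (exp_series \<iota> f) = exp_series \<iota> f * fps_deriv f"
proof -
  interpret comm_ring_hom \<iota> by fact
  let ?E = "Abs_fps (\<lambda>n. \<iota> (1 / fact n))"
  have "fps_deriv ?E = ?E"
  proof (rule fps_ext)
    fix n
    have "of_nat (Suc n) * \<iota> (1 / fact (Suc n)) = \<iota> (of_nat (Suc n) * (1 / fact (Suc n)))"
      by (simp only: hom_mult hom_of_nat)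
    also have "of_nat (Suc n) * (1 / fact (Suc n)) = (1 / fact n :: complex)"
      by (simp add: fact_Suc del: of_nat_Suc)
    finally show "fps_nth (fps_deriv ?E) n = fps_nth ?E n"
      by (simp del: of_nat_Suc)
  qed
  then show ?thesis
    by (simp add: exp_series_def fps_compose_deriv_comm_ring[OF assms(2)])
qed

lemma log_series_nth_0: "fps_nth (log_series \<iota> f) 0 = 0"
  by (simp add: log_series_def)

text \<open>The derivative of log(1 + X) is the alternating geometric series, an inverse of 1 + X.
  Substituting \<open>f - 1\<close> for X makes it an inverse of \<open>f\<close>, and the chain
  rule gives the claim, stated without division.\<close>

lemma log_series_deriv:
  assumes "comm_ring_hom \<iota>" "fps_nth f 0 = 1"
  shows "f * fps_deriv (log_series \<iota> f) = fps_deriv f"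
proof -
  interpret comm_ring_hom \<iota> by fact
  let ?L = "Abs_fps (\<lambda>n. if n = 0 then 0 else \<iota> ((-1) ^ (n + 1) / of_nat n))"
  have f0: "fps_nth (f - 1) 0 = 0" using assms(2) by simp
  have L': "fps_nth (fps_deriv ?L) n = (- 1) ^ n" for n
  proof -
    have "of_nat (Suc n) * \<iota> ((-1) ^ (Suc n + 1) / of_nat (Suc n)) =
        \<iota> (of_nat (Suc n) * ((-1) ^ (Suc n + 1) / of_nat (Suc n)))"
      by (simp only: hom_mult hom_of_nat)
    also have "of_nat (Suc n) * ((-1) ^ (Suc n + 1) / of_nat (Suc n)) = ((- 1) ^ n :: complex)"
      by (simp del: of_nat_Suc)
    finally show ?thesis by (simp add: hom_power hom_uminus del: of_nat_Suc)
  qed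
  have "(1 + fps_X) * fps_deriv ?L = 1"
  proof (rule fps_ext)
    fix n
    show "fps_nth ((1 + fps_X) * fps_deriv ?L) n = fps_nth 1 n"
      by (cases n) (simp_all only: distrib_right mult_1 fps_add_nth fps_X_mult_nth L' fps_one_nth, simp_all)
  qed
  then have "fps_compose ((1 + fps_X) * fps_deriv ?L) (f - 1) = 1" by simp
  moreover have "fps_compose (1 + fps_X) (f - 1) = f"
    using f0 by (simp add: fps_compose_add_distrib)
  ultimately have "f * fps_compose (fps_deriv ?L) (f - 1) = 1"
    by (simp only: fps_compose_mult_distrib_comm_ring[OF f0])
  then show ?thesis
    by (simp add: log_series_def fps_compose_deriv_comm_ring[OF f0] flip: mult.assoc)
qed

lemma log_series_eq_uminus_iff:
  fixes \<iota> :: "complex \<Rightarrow> 'r::comm_ring_1"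
  assumes \<iota>: "comm_ring_hom \<iota>" and A0: "fps_nth A 0 = 1" and H0: "fps_nth H 0 = 0"
  shows "log_series \<iota> A = - H \<longleftrightarrow> exp_series \<iota> H * A = 1"
proof -
  let ?S = "exp_series \<iota> H"
  note S0 = exp_series_nth_0[OF \<iota>, of H]
  \<comment> \<open>A series with constant term 1 is a unit over any commutative ring. This makes
    multiplication by \<open>A\<close> and by \<open>?S\<close> reversible in the chain
    below.\<close>
  have cancel: "f * x = f * y \<longleftrightarrow> x = y" if "fps_nth f 0 = 1" for f x y :: "'r fps"
    using fps_right_inverse[of f 1] that
    by (intro left_inverse_imp_mult_cancel) (simp add: mult.commute)
  have "log_series \<iota> A = - H \<longleftrightarrow> fps_deriv (log_series \<iota> A) = fps_deriv (- H)"
    using H0 by (subst fps_deriv_cancel_hom[OF \<iota>]) (simp_all add: log_series_nth_0)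
  also have "\<dots> \<longleftrightarrow> A * fps_deriv (log_series \<iota> A) = A * fps_deriv (- H)"
    by (simp only: cancel[OF A0])
  also have "\<dots> \<longleftrightarrow> fps_deriv A = - (fps_deriv H * A)"
    by (simp add: log_series_deriv[OF \<iota> A0] mult.commute)
  also have "\<dots> \<longleftrightarrow> ?S * fps_deriv A = ?S * - (fps_deriv H * A)"
    by (simp only: cancel[OF S0])
  also have "\<dots> \<longleftrightarrow> fps_deriv (?S * A) = fps_deriv 1"
    by (simp add: exp_series_deriv[OF \<iota> H0] eq_neg_iff_add_eq_0 algebra_simps)
  \<comment> \<open>Both sides have constant term 1, so equal derivatives suffice.\<close>
  also have "\<dots> \<longleftrightarrow> ?S * A = 1"
    using A0 S0 by (subst fps_deriv_cancel_hom[OF \<iota>]) simp_all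
  finally show ?thesis .
qed

text \<open>Each coefficient of the logarithm is a finite sum of products of scalars and
  coefficients of \<open>f - 1\<close>, so a ring homomorphism passes through it. This allows
  evaluating the Faber polynomials inside the logarithm.\<close>

lemma hom_log_series_nth:
  assumes "comm_ring_hom h"
  shows "h (fps_nth (log_series \<iota> f) n) =
    fps_nth (log_series (\<lambda>c. h (\<iota> c)) (Abs_fps (\<lambda>n. h (fps_nth f n)))) n"
proof -
  interpret comm_ring_hom h by fact
  have "h (fps_nth (g ^ i) n) = fps_nth (Abs_fps (\<lambda>n. h (fps_nth g n)) ^ i) n" for g i n
    by (induction i arbitrary: n) (simp_all add: fps_mult_nth hom_sum hom_mult)
  moreover have "Abs_fps (\<lambda>n. h (fps_nth (f - 1) n)) = Abs_fps (\<lambda>n. h (fps_nth f n)) - 1"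
    by (rule fps_ext) (simp add: hom_minus)
  ultimately show ?thesis
    by (auto simp: log_series_def fps_compose_nth hom_sum hom_mult intro!: sum.cong)
qed


section \<open>Replicability\<close>

lemma comm_ring_hom_fls_const: "comm_ring_hom (fls_const :: 'a::comm_ring_1 \<Rightarrow> 'a fls)"
  by unfold_locales (simp_all add: fls_plus_const)

lemma comm_ring_hom_fls_const_scalar: "comm_ring_hom (\<lambda>c. fls_const (scalar c :: 'g \<Rightarrow> complex))"
proof -
  interpret comm_ring_hom "fls_const :: ('g \<Rightarrow> complex) \<Rightarrow> _" by (rule comm_ring_hom_fls_const)
  have "scalar (c + d) = (scalar c + scalar d :: 'g \<Rightarrow> complex)"
    "scalar (c * d) = (scalar c * scalar d :: 'g \<Rightarrow> complex)"
    "scalar 0 = (0 :: 'g \<Rightarrow> complex)" "scalar 1 = (1 :: 'g \<Rightarrow> complex)" for c d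
    by (simp_all add: fun_eq_iff)
  then show ?thesis
    by unfold_locales (simp_all only: hom_add hom_mult hom_zero hom_one)
qed

text \<open>With \<open>fls_const\<close> for \<open>h\<close> and \<open>F\<close> for
  \<open>x\<close>, this map is the substitution of F(q) for w.\<close>

lemma comm_ring_hom_poly_map_poly:
  assumes "comm_ring_hom h"
  shows "comm_ring_hom (\<lambda>p. poly (map_poly h p) x)"
proof -
  interpret comm_ring_hom h by fact
  have add: "map_poly h (p + q) = map_poly h p + map_poly h q" for p q
    by (rule poly_eqI) (simp add: coeff_map_poly hom_add)
  have "map_poly h (p * q) = map_poly h p * map_poly h q" for p q
    by (induction p) (simp_all add: add map_poly_pCons map_poly_smult hom_mult)
  with add show ?thesis
    by unfold_locales simp_all
qed

text \<open>Substituting F(q) for w is a ring homomorphism that carries t (F(t) - w) coefficientwise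
  to t (F(t) - F(q)), and it commutes with taking coefficients of the logarithm.\<close>

lemma poly_faber:
  "poly (map_poly fls_const (faber m F)) F =
    - of_nat m * fps_nth (log_series (\<lambda>c. fls_const (scalar c)) (t_times_diff fls_const F F)) m"
proof -
  let ?h = "\<lambda>p. poly (map_poly fls_const p) F"
  interpret c: comm_ring_hom "fls_const :: ('a \<Rightarrow> complex) \<Rightarrow> _" by (rule comm_ring_hom_fls_const)
  interpret comm_ring_hom ?h by (rule comm_ring_hom_poly_map_poly[OF comm_ring_hom_fls_const])
  have const: "?h [:c:] = fls_const c" for c by (simp add: map_poly_pCons)
  have "?h [:0, 1:] = F" by (simp add: map_poly_pCons)
  then have "?h (fps_nth (t_times_diff (\<lambda>c. [:c:]) F [:0, 1:]) n) =
      fps_nth (t_times_diff fls_const F F) n" for n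
    by (simp only: t_times_diff_def fps_sub_nth fps_nth_Abs_fps fps_mult_left_const_nth
        fps_X_nth hom_minus hom_mult const if_distrib[of ?h] hom_zero hom_one)
  then have "Abs_fps (\<lambda>n. ?h (fps_nth (t_times_diff (\<lambda>c. [:c:]) F [:0, 1:]) n)) =
      t_times_diff fls_const F F"
    by (intro fps_ext) (simp only: fps_nth_Abs_fps)
  then show ?thesis
    by (simp only: faber_def hom_mult hom_uminus hom_of_nat const
        hom_log_series_nth[OF comm_ring_hom_axioms])
qed

lemma of_nat_mult_hecke:
  assumes "m \<ge> 1"
  shows "of_nat m * hecke G m F = hecke_sum G m F"
proof -
  interpret comm_ring_hom "\<lambda>c. fls_const (scalar c :: 'a \<Rightarrow> complex)"
    by (rule comm_ring_hom_fls_const_scalar)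
  have "of_nat m * fls_const (scalar (1 / of_nat m) :: 'a \<Rightarrow> complex) =
      fls_const (scalar (of_nat m * (1 / of_nat m)))"
    by (simp only: hom_mult hom_of_nat)
  also have "\<dots> = 1" using assms by simp
  finally show ?thesis by (simp add: hecke_def flip: mult.assoc)
qed

text \<open>Since \<open>ext_tate\<close> is the inverse of the symmetric power series at -t, its
  own value at -t is the inverse of \<open>sym_tate\<close>.\<close>

lemma sym_tate_mult_eq_1_iff:
  "sym_tate G F * A = 1 \<longleftrightarrow> A = fps_compose (ext_tate G F) (- fps_X)"
proof -
  let ?E = "fps_compose (ext_tate G F) (- fps_X)"
  \<comment> \<open>Replacing t by -t a second time undoes the sign in the first factor.\<close>
  have "fps_compose (fps_compose (sym_tate G F) (- fps_X) * ext_tate G F) (- fps_X) = 1"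
    by (simp add: ext_tate_inverse)
  then have "sym_tate G F * ?E = 1"
    by (simp add: fps_compose_mult_distrib_comm_ring fps_compose_uminus_X_involution)
  then show ?thesis
    using left_inverse_imp_mult_cancel[of ?E "sym_tate G F" A ?E] by (simp add: mult.commute)
qed

theorem mainTheorem5:
  fixes G :: "('g, 'x) monoid_scheme" and F :: "('g \<Rightarrow> complex) fls"
  assumes "group G" and "finite (carrier G)" and "mckay_thompson G F"
  shows "replicable G F \<longleftrightarrow>
    t_times_diff fls_const F F = fps_compose (ext_tate G F) (- fps_X)"
proof -
  define \<iota> where "\<iota> = (\<lambda>c. fls_const (scalar c :: 'g \<Rightarrow> complex))"
  define A where "A = t_times_diff fls_const F F"
  define H where "H = Abs_fps (\<lambda>m. if m = 0 then 0 else hecke G m F)"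
  have \<iota>: "comm_ring_hom \<iota>" unfolding \<iota>_def by (rule comm_ring_hom_fls_const_scalar)
  \<comment> \<open>The factor t shifts degrees by one, so this is the coefficient of
    \<open>F\<close> at -1; the term in F(q) starts in degree 1 of t.\<close>
  have A0: "fps_nth A 0 = 1"
    using assms(3) by (simp add: A_def t_times_diff_def mckay_thompson_def)
  have H0: "fps_nth H 0 = 0" by (simp add: H_def)
  have "replicable G F \<longleftrightarrow>
      (\<forall>m\<ge>1. of_nat m * - fps_nth (log_series \<iota> A) m = of_nat m * hecke G m F)"
    by (simp add: replicable_def poly_faber of_nat_mult_hecke \<iota>_def A_def)
  also have "\<dots> \<longleftrightarrow> (\<forall>m\<ge>1. - fps_nth (log_series \<iota> A) m = fps_nth H m)"
    using of_nat_mult_cancel_hom[OF \<iota>] by (auto simp: H_def simp del: mult_minus_right)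
  \<comment> \<open>Replicability says nothing in degree 0, where both series vanish.\<close>
  also have "\<dots> \<longleftrightarrow> log_series \<iota> A = - H"
  proof
    assume eq: "\<forall>m\<ge>1. - fps_nth (log_series \<iota> A) m = fps_nth H m"
    show "log_series \<iota> A = - H"
    proof (rule fps_ext)
      fix m
      show "fps_nth (log_series \<iota> A) m = fps_nth (- H) m"
        using eq[rule_format, of m] H0
        by (cases "m = 0") (auto simp: log_series_nth_0 minus_equation_iff)
    qed
  qed simp
  also have "\<dots> \<longleftrightarrow> sym_tate G F * A = 1"
    using log_series_eq_uminus_iff[OF \<iota> A0 H0]
    by (simp only: sym_tate_def \<iota>_def H_def)
  finally show ?thesis
    by (simp add: sym_tate_mult_eq_1_iff A_def)
qed

end
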